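(* A digraph $D=(V,A)$ is antistrong if and only if the cycle matroid $M(B(D))$ of its bipartite representation has rank $2|V|-1$.
   Context: Digraphs are finite and loopless. In a walk (in the underlying graph) an arc $vw$ is forward if traversed from $v$ to $w$ and backward if traversed from $w$ to $v$. An antidirected trail is a walk with no repeated arc whose arcs alternate between forward and backward; it is a forward antidirected trail if it begins and ends with a forward arc. A digraph is antistrong if it has at least three vertices and contains a forward antidirected $(x,y)$-trail for every pair of distinct vertices $x,y$. The bipartite representation of $D=(V,A)$ is the bipartite graph $B(D)$ with vertex set $V'\cup V''$ (two disjoint copies $V'=\{v'\}$, $V''=\{v''\}$ of $V$) and edge set $\{v'w'':vw\in A\}$. The cycle matroid of a graph has the edge set as ground set and the edge sets of forests as independent sets. *)

theory Defs
  imports "Graph_Theory.Digraph"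
begin

section \<open>Antidirected trails\<close>

text \<open>
  A walk in the underlying graph is given by its start vertex and its list of steps. A step
  is an arc together with a flag: \<^const>\<open>True\<close> if the arc is traversed forward (from tail
  to head), \<^const>\<open>False\<close> if it is traversed backward. Parallel arcs are permitted; they
  are distinct as arcs.
\<close>

type_synonym 'b step = "'b \<times> bool"

definition step_source :: "('a, 'b) pre_digraph \<Rightarrow> 'b step \<Rightarrow> 'a" where
  "step_source D s = (if snd s then tail D (fst s) else head D (fst s))"

definition step_target :: "('a, 'b) pre_digraph \<Rightarrow> 'b step \<Rightarrow> 'a" where
  "step_target D s = (if snd s then head D (fst s) else tail D (fst s))"

fun underlying_walk :: "('a, 'b) pre_digraph \<Rightarrow> 'a \<Rightarrow> 'b step list \<Rightarrow> 'a \<Rightarrow> bool" where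
  "underlying_walk D x [] y \<longleftrightarrow> x \<in> verts D \<and> x = y"
| "underlying_walk D x (s # ss) y \<longleftrightarrow>
     fst s \<in> arcs D \<and> step_source D s = x \<and> underlying_walk D (step_target D s) ss y"

definition antidirected_trail :: "('a, 'b) pre_digraph \<Rightarrow> 'a \<Rightarrow> 'b step list \<Rightarrow> 'a \<Rightarrow> bool" where
  "antidirected_trail D x ss y \<longleftrightarrow>
     underlying_walk D x ss y \<and> distinct (map fst ss) \<and>
     successively (\<lambda>s t. snd s \<noteq> snd t) ss"

definition forward_antidirected_trail ::
    "('a, 'b) pre_digraph \<Rightarrow> 'a \<Rightarrow> 'b step list \<Rightarrow> 'a \<Rightarrow> bool" where
  "forward_antidirected_trail D x ss y \<longleftrightarrow>
     antidirected_trail D x ss y \<and> ss \<noteq> [] \<and> snd (hd ss) \<and> snd (last ss)"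

definition antistrong :: "('a, 'b) pre_digraph \<Rightarrow> bool" where
  "antistrong D \<longleftrightarrow> 3 \<le> card (verts D) \<and>
     (\<forall>x \<in> verts D. \<forall>y \<in> verts D. x \<noteq> y \<longrightarrow> (\<exists>ss. forward_antidirected_trail D x ss y))"


section \<open>Undirected graphs and the bipartite representation\<close>

text \<open>Edges are two-element sets of vertices.\<close>

record 'v ugraph =
  uverts :: "'v set"
  uedges :: "'v set set"

text \<open>The copy of \<open>v\<close> in \<open>V'\<close> is \<^term>\<open>Inl v\<close>, the copy in \<open>V''\<close> is \<^term>\<open>Inr v\<close>.\<close>

definition bipartite_representation :: "('a, 'b) pre_digraph \<Rightarrow> ('a + 'a) ugraph" where
  "bipartite_representation D =
     \<lparr> uverts = Inl ` verts D \<union> Inr ` verts D,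
       uedges = {{Inl v, Inr w} | v w. (v, w) \<in> arcs_ends D} \<rparr>"

text \<open>
  A cycle is given by its vertices in cyclic order. At least three distinct vertices are
  required, so that traversing one edge back and forth does not count.
\<close>

definition ucycle :: "'v ugraph \<Rightarrow> 'v list \<Rightarrow> bool" where
  "ucycle G vs \<longleftrightarrow> 3 \<le> length vs \<and> distinct vs \<and> set vs \<subseteq> uverts G \<and>
     (\<forall>i < length vs. {vs ! i, vs ! (Suc i mod length vs)} \<in> uedges G)"

definition forest :: "'v ugraph \<Rightarrow> bool" where
  "forest G \<longleftrightarrow> \<not> (\<exists>vs. ucycle G vs)"


section \<open>Cycle matroid and rank\<close>

record 'e matroid =
  ground :: "'e set"
  indep :: "'e set set"

definition cycle_matroid :: "'v ugraph \<Rightarrow> 'v set matroid" where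
  "cycle_matroid G =
     \<lparr> ground = uedges G,
       indep = {F. F \<subseteq> uedges G \<and> forest \<lparr> uverts = uverts G, uedges = F \<rparr>} \<rparr>"

text \<open>The maximum is meaningful for a finite ground set, since the empty set is independent.\<close>

definition matroid_rank :: "'e matroid \<Rightarrow> nat" where
  "matroid_rank M = Max (card ` indep M)"

end

(*
  A simple path of B(D) from x' to y'' lifts to a forward antidirected (x,y)-trail of D, and every
  such trail projects to a walk of B(D) from x' to y''. With at least three vertices this makes
  antistrongness equivalent to connectedness of B(D); with at most two, loop-freeness
  disconnects x' from x''. Since every forest F on V has card V - card F components, a maximum
  forest of a graph on V has card V - 1 edges iff the graph is connected.
*)
theory Submission
  imports Defs
begin

section \<open>Connectivity of undirected graphs\<close>

definition adj :: "'v set set \<Rightarrow> ('v \<times> 'v) set" where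
  "adj F = {(a, b). {a, b} \<in> F}"

definition component :: "'v set set \<Rightarrow> 'v \<Rightarrow> 'v set" where
  "component F x = {y. (x, y) \<in> (adj F)\<^sup>*}"

text \<open>The edge set of the complete graph on \<open>V\<close>;
  \<open>F \<subseteq> edges_on V\<close> says that \<open>F\<close> has no loops and lives on
  \<open>V\<close>.\<close>

definition edges_on :: "'v set \<Rightarrow> 'v set set" where
  "edges_on V = {{a, b} | a b. a \<in> V \<and> b \<in> V \<and> a \<noteq> b}"

lemma adj_iff [simp]: "(a, b) \<in> adj F \<longleftrightarrow> {a, b} \<in> F"
  by (simp add: adj_def)

lemma adj_mono: "F \<subseteq> G \<Longrightarrow> adj F \<subseteq> adj G"
  by auto

lemma adj_insert: "adj (insert {u, v} F) = insert (u, v) (insert (v, u) (adj F))"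
  by (auto simp: doubleton_eq_iff)

lemma adj_rtrancl_sym: "(a, b) \<in> (adj F)\<^sup>* \<Longrightarrow> (b, a) \<in> (adj F)\<^sup>*"
  by (metis adj_iff insert_commute sym_def sym_rtrancl)

lemma edges_on_doubleton: "{a, b} \<in> edges_on V \<longleftrightarrow> a \<in> V \<and> b \<in> V \<and> a \<noteq> b"
  by (auto simp: edges_on_def doubleton_eq_iff)

lemma finite_edges_on: "finite V \<Longrightarrow> finite (edges_on V)"
  by (rule finite_subset[of _ "Pow V"]) (auto simp: edges_on_def)

lemma component_eq_iff: "component F x = component F y \<longleftrightarrow> (x, y) \<in> (adj F)\<^sup>*"
proof
  assume "component F x = component F y"
  then have "y \<in> component F x" by (simp add: component_def)
  then show "(x, y) \<in> (adj F)\<^sup>*" by (simp add: component_def)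
next
  assume "(x, y) \<in> (adj F)\<^sup>*"
  then have "(x, z) \<in> (adj F)\<^sup>* \<longleftrightarrow> (y, z) \<in> (adj F)\<^sup>*" for z
    by (meson adj_rtrancl_sym rtrancl_trans)
  then show "component F x = component F y" by (simp add: component_def)
qed

lemma mem_component_iff: "y \<in> component F x \<longleftrightarrow> component F x = component F y"
  by (simp add: component_eq_iff) (simp add: component_def)

lemma component_empty [simp]: "component {} x = {x}"
  by (simp add: component_def adj_def)

text \<open>A walk needs the new edge at most once, in one of its two directions; these are the
  second and third alternatives below. The formula also covers \<open>u\<close> and \<open>v\<close>
  already being connected, where the union is a single class.\<close>

lemma component_insert:
  "component (insert {u, v} F) x =
     (if x \<in> component F u \<union> component F v then component F u \<union> component F v
      else component F x)"
proof -
  have "(x, y) \<in> (adj (insert {u, v} F))\<^sup>* \<longleftrightarrow>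
      component F x = component F y \<or>
      component F x = component F u \<and> component F v = component F y \<or>
      component F x = component F v \<and> component F u = component F y" for y
    unfolding adj_insert rtrancl_insert mem_Collect_eq Un_iff case_prod_conv
      component_eq_iff[symmetric] by metis
  then have "y \<in> component (insert {u, v} F) x \<longleftrightarrow>
      component F x = component F y \<or>
      component F x = component F u \<and> component F v = component F y \<or>
      component F x = component F v \<and> component F u = component F y" for y
    unfolding component_def mem_Collect_eq .
  then show ?thesis by (auto simp: mem_component_iff)
qed

lemma card_components_insert:
  assumes "finite V" "u \<in> V" "v \<in> V" "(u, v) \<notin> (adj F)\<^sup>*"
  shows "Suc (card (component (insert {u, v} F) ` V)) = card (component F ` V)"
proof -
  let ?C = "component F ` V" and ?u = "component F u" and ?v = "component F v"
  have ne: "?u \<noteq> ?v" using assms(4) by (simp add: component_eq_iff)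
  have img: "component (insert {u, v} F) ` V = insert (?u \<union> ?v) (?C - {?u, ?v})"
  proof (intro equalityI subsetI)
    fix X assume "X \<in> component (insert {u, v} F) ` V"
    then show "X \<in> insert (?u \<union> ?v) (?C - {?u, ?v})"
      by (auto simp: component_insert mem_component_iff)
  next
    fix X assume "X \<in> insert (?u \<union> ?v) (?C - {?u, ?v})"
    then consider "X = ?u \<union> ?v" | x where "x \<in> V" "X = component F x" "X \<noteq> ?u" "X \<noteq> ?v"
      by auto
    then show "X \<in> component (insert {u, v} F) ` V"
    proof cases
      case 1
      then have "X = component (insert {u, v} F) u"
        by (simp add: component_insert mem_component_iff)
      then show ?thesis using assms(2) by blast
    next
      case 2
      then have "X = component (insert {u, v} F) x"
        by (auto simp: component_insert mem_component_iff)
      then show ?thesis using 2 by blast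
    qed
  qed
  \<comment> \<open>Needed for the merged class to raise the count by one: a class equal to the
    union would contain \<open>u\<close> and so be \<open>?u\<close> itself.\<close>
  have new: "?u \<union> ?v \<notin> ?C - {?u, ?v}"
  proof
    assume "?u \<union> ?v \<in> ?C - {?u, ?v}"
    then obtain x where x: "component F x = ?u \<union> ?v" "component F x \<noteq> ?u" by auto
    then have "u \<in> component F x" by (simp add: mem_component_iff)
    then show False using x(2) by (simp add: mem_component_iff)
  qed
  have "card (component (insert {u, v} F) ` V) = Suc (card (?C - {?u, ?v}))"
    unfolding img using new assms(1) by simp
  also have "card (?C - {?u, ?v}) = card ?C - 2"
    using assms(1-3) ne by (subst card_Diff_subset) auto
  finally have "card (component (insert {u, v} F) ` V) = Suc (card ?C - 2)" .
  \<comment> \<open>Excludes truncation in \<open>card ?C - 2\<close>.\<close>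
  moreover have "2 \<le> card ?C"
    using card_mono[of ?C "{?u, ?v}"] assms(1-3) ne by auto
  ultimately show ?thesis by simp
qed

text \<open>Vertices are prepended one at a time; if the new one is already on the path, the suffix
  starting at it is kept instead.\<close>

lemma rtrancl_simple_path:
  assumes "(u, v) \<in> r\<^sup>*"
  obtains vs where "vs \<noteq> []" "hd vs = u" "last vs = v" "distinct vs"
    "successively (\<lambda>a b. (a, b) \<in> r) vs"
proof -
  have "\<exists>vs. vs \<noteq> [] \<and> hd vs = u \<and> last vs = v \<and> distinct vs \<and>
      successively (\<lambda>a b. (a, b) \<in> r) vs"
    using assms
  proof (induction rule: converse_rtrancl_induct)
    case base
    show ?case by (rule exI[of _ "[v]"]) simp
  next
    case (step y z)
    then obtain vs where vs: "vs \<noteq> []" "hd vs = z" "last vs = v" "distinct vs"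
      "successively (\<lambda>a b. (a, b) \<in> r) vs" by blast
    show ?case
    proof (cases "y \<in> set vs")
      case True
      then obtain xs ys where "vs = xs @ y # ys" by (meson split_list)
      then show ?thesis using vs
        by (intro exI[of _ "y # ys"]) (auto simp: successively_append_iff)
    next
      case False
      then show ?thesis using vs step.hyps
        by (intro exI[of _ "y # vs"]) (auto simp: successively_Cons)
    qed
  qed
  then show thesis using that by blast
qed

section \<open>Forests and the rank of the cycle matroid\<close>

text \<open>A simple path from \<open>u\<close> to \<open>v\<close> in \<open>F\<close> is closed to
  a cycle by the new edge. It has at least three vertices, since one would give \<open>u = v\<close>
  and two would put \<open>{u, v}\<close> in \<open>F\<close>.\<close>

lemma not_forest_insert:
  assumes F: "insert {u, v} F \<subseteq> edges_on V"
    and new: "{u, v} \<notin> F" and conn: "(u, v) \<in> (adj F)\<^sup>*"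
  shows "\<not> forest \<lparr>uverts = V, uedges = insert {u, v} F\<rparr>"
proof -
  have uv: "u \<in> V" "u \<noteq> v" using F by (auto simp: edges_on_doubleton)
  obtain vs where vs: "vs \<noteq> []" "hd vs = u" "last vs = v" "distinct vs"
    "successively (\<lambda>a b. (a, b) \<in> adj F) vs"
    using rtrancl_simple_path[OF conn] by metis
  have edge: "{vs ! i, vs ! Suc i} \<in> F" if "Suc i < length vs" for i
    using vs(5) that by (simp add: successively_conv_nth)
  have u: "u = vs ! 0" and v: "v = vs ! (length vs - 1)"
    using vs(1-3) by (auto simp: hd_conv_nth last_conv_nth)
  have len: "3 \<le> length vs"
  proof (rule ccontr)
    assume "\<not> 3 \<le> length vs"
    then have "length vs = 0 \<or> length vs = 1 \<or> length vs = 2" by linarith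
    then show False using vs(1) u v uv(2) new edge[of 0] by auto
  qed
  have "vs ! i \<in> V" if "i < length vs" for i
  proof (cases i)
    case 0
    then show ?thesis using u uv by simp
  next
    case (Suc j)
    then have "{vs ! j, vs ! i} \<in> edges_on V" using edge[of j] that F by auto
    then show ?thesis by (simp add: edges_on_doubleton)
  qed
  then have sub: "set vs \<subseteq> V" by (auto simp: in_set_conv_nth)
  have "{vs ! i, vs ! (Suc i mod length vs)} \<in> insert {u, v} F" if "i < length vs" for i
  proof (cases "Suc i < length vs")
    case True
    then show ?thesis using edge by simp
  next
    case False
    then have "Suc i = length vs" using that by simp
    then have "{vs ! i, vs ! (Suc i mod length vs)} = {u, v}"
      using u v by (auto simp: insert_commute dest: sym)
    then show ?thesis by simp
  qed
  then show ?thesis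
    using len vs(4) sub unfolding forest_def ucycle_def by auto
qed

text \<open>A cycle must use the new edge, since \<open>F\<close> has none; the rest of the cycle
  would then connect \<open>u\<close> and \<open>v\<close> within \<open>F\<close>.\<close>

lemma forest_insert:
  assumes F: "forest \<lparr>uverts = V, uedges = F\<rparr>" and conn: "(u, v) \<notin> (adj F)\<^sup>*"
  shows "forest \<lparr>uverts = V, uedges = insert {u, v} F\<rparr>"
  unfolding forest_def
proof
  assume "\<exists>vs. ucycle \<lparr>uverts = V, uedges = insert {u, v} F\<rparr> vs"
  then obtain vs where len: "3 \<le> length vs" and dist: "distinct vs" and sub: "set vs \<subseteq> V"
    and edges: "\<And>i. i < length vs \<Longrightarrow> {vs ! i, vs ! (Suc i mod length vs)} \<in> insert {u, v} F"
    by (auto simp: ucycle_def)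
  let ?n = "length vs"
  let ?e = "\<lambda>i. {vs ! i, vs ! (Suc i mod ?n)}"
  have "\<not> (\<forall>i < ?n. ?e i \<in> F)"
    using F len dist sub by (auto simp: forest_def ucycle_def)
  then obtain i where i: "i < ?n" "?e i = {u, v}" using edges by blast
  \<comment> \<open>The new edge occurs only once on the cycle: an occurrence with swapped ends
    would force length 2.\<close>
  have inj: "j = i" if "j < ?n" "?e j = ?e i" for j
  proof -
    have mod: "Suc k mod ?n = (if Suc k = ?n then 0 else Suc k)" if "k < ?n" for k
      using that by auto
    have lt: "m mod ?n < ?n" for m using len by (intro mod_less_divisor) linarith
    have "j = i \<or> (j = Suc i mod ?n \<and> i = Suc j mod ?n)"
      using that i(1) lt dist by (auto simp: doubleton_eq_iff nth_eq_iff_index_eq)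
    then show ?thesis
      using that(1) i(1) len by (auto simp: mod split: if_splits)
  qed
  \<comment> \<open>The walk starts just behind edge \<open>i\<close> and goes round the cycle. It
    reaches index \<open>i\<close> only after \<open>?n - 1\<close> steps, so every edge it
    traverses lies in \<open>F\<close>.\<close>
  have walk: "(vs ! (Suc i mod ?n), vs ! ((Suc i + k) mod ?n)) \<in> (adj F)\<^sup>*" if "k < ?n" for k
    using that
  proof (induction k)
    case 0
    show ?case by simp
  next
    case (Suc k)
    let ?j = "(Suc i + k) mod ?n"
    have "?j < ?n" using len by (intro mod_less_divisor) linarith
    moreover have "?j \<noteq> i"
    proof
      assume "?j = i"
      then have "(i + Suc k) mod ?n = i mod ?n" using i(1) by simp
      then have "?n dvd Suc k" by (metis add_diff_cancel_left' mod_eq_dvd_iff_nat le_add1)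
      then show False using Suc.prems by (auto dest: dvd_imp_le)
    qed
    ultimately have "?e ?j \<in> F" using inj[of ?j] edges[of ?j] i(2) by auto
    moreover have "Suc ?j mod ?n = (Suc i + Suc k) mod ?n" by (simp add: mod_Suc_eq)
    ultimately have "(vs ! ?j, vs ! ((Suc i + Suc k) mod ?n)) \<in> adj F" by simp
    then show ?case using Suc by (meson Suc_lessD rtrancl.rtrancl_into_rtrancl)
  qed
  have "Suc i + (?n - 1) = i + ?n" using len by simp
  then have "(Suc i + (?n - 1)) mod ?n = i" using i(1) by simp
  then have "(vs ! (Suc i mod ?n), vs ! i) \<in> (adj F)\<^sup>*"
    using walk[of "?n - 1"] len by (simp del: add_Suc)
  then have "(u, v) \<in> (adj F)\<^sup>* \<or> (v, u) \<in> (adj F)\<^sup>*"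
    using i(2) by (auto simp: doubleton_eq_iff)
  then show False using conn adj_rtrancl_sym by metis
qed

lemma forest_subset:
  "forest \<lparr>uverts = V, uedges = G\<rparr> \<Longrightarrow> F \<subseteq> G \<Longrightarrow> forest \<lparr>uverts = V, uedges = F\<rparr>"
  by (fastforce simp: forest_def ucycle_def)

text \<open>By induction on the edges: without edges every vertex is its own component, and each
  edge added to a forest merges two components, as it would otherwise close a cycle.\<close>

lemma card_forest:
  assumes V: "finite V" and "F \<subseteq> edges_on V" and "forest \<lparr>uverts = V, uedges = F\<rparr>"
  shows "card F + card (component F ` V) = card V"
proof -
  have "finite F" using assms finite_edges_on finite_subset by blast
  then show ?thesis using assms(2,3)
  proof (induction F)
    case empty
    have "component {} ` V = (\<lambda>x. {x}) ` V" by simp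
    then show ?case by (simp add: card_image)
  next
    case (insert e F)
    then obtain u v where e: "e = {u, v}" "u \<in> V" "v \<in> V" by (auto simp: edges_on_def)
    have "(u, v) \<notin> (adj F)\<^sup>*"
      using insert.hyps(2) insert.prems not_forest_insert[of u v F V] unfolding e(1) by metis
    then have "Suc (card (component (insert e F) ` V)) = card (component F ` V)"
      unfolding e(1) by (rule card_components_insert[OF V e(2,3)])
    moreover have "card F + card (component F ` V) = card V"
      using insert.IH insert.prems forest_subset[of V "insert e F" F] by (simp add: subset_insertI)
    ultimately show ?case using insert.hyps by simp
  qed
qed

lemma card_components_eq_1_iff:
  assumes "finite V" "V \<noteq> {}"
  shows "card (component F ` V) = 1 \<longleftrightarrow> (\<forall>x\<in>V. \<forall>y\<in>V. (x, y) \<in> (adj F)\<^sup>*)"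
proof -
  obtain x where x: "x \<in> V" using assms(2) by blast
  have "card (component F ` V) = 1 \<longleftrightarrow> (\<forall>a\<in>V. \<forall>b\<in>V. component F a = component F b)"
  proof
    assume "card (component F ` V) = 1"
    then obtain C where C: "component F ` V = {C}" by (rule card_1_singletonE)
    have "component F a = C" if "a \<in> V" for a
      using imageI[OF that, of "component F"] by (simp add: C)
    then show "\<forall>a\<in>V. \<forall>b\<in>V. component F a = component F b" by simp
  next
    assume const: "\<forall>a\<in>V. \<forall>b\<in>V. component F a = component F b"
    have "component F ` V = (\<lambda>_. component F x) ` V"
      by (rule image_cong[OF refl], rule const[rule_format, OF _ x])
    also have "\<dots> = {component F x}" by (rule image_constant[OF x])
    finally show "card (component F ` V) = 1" by simp
  qed
  then show ?thesis by (simp add: component_eq_iff)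
qed

text \<open>A forest \<open>F\<close> of maximum size has the same components as \<open>E\<close>,
  so \<open>card_forest\<close> turns the rank into a component count. The form with
  \<open>Suc\<close> avoids natural subtraction.\<close>

lemma matroid_rank_connected_iff:
  assumes V: "finite V" "V \<noteq> {}" and E: "E \<subseteq> edges_on V"
  shows "Suc (matroid_rank (cycle_matroid \<lparr>uverts = V, uedges = E\<rparr>)) = card V \<longleftrightarrow>
    (\<forall>x\<in>V. \<forall>y\<in>V. (x, y) \<in> (adj E)\<^sup>*)"
proof -
  let ?I = "indep (cycle_matroid \<lparr>uverts = V, uedges = E\<rparr>)"
  let ?r = "matroid_rank (cycle_matroid \<lparr>uverts = V, uedges = E\<rparr>)"
  have I: "F \<in> ?I \<longleftrightarrow> F \<subseteq> E \<and> forest \<lparr>uverts = V, uedges = F\<rparr>" for F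
    by (simp add: cycle_matroid_def)
  have finE: "finite E" using E V(1) finite_edges_on finite_subset by blast
  have "?I \<subseteq> Pow E" using I by blast
  then have finI: "finite ?I" using finE finite_subset by blast
  \<comment> \<open>Makes the set under \<open>Max\<close> nonempty, so that some forest attains the
    rank.\<close>
  have "{} \<in> ?I" by (auto simp: I forest_def ucycle_def intro!: exI[of _ 0])
  then have "Max (card ` ?I) \<in> card ` ?I" using finI by (intro Max_in) auto
  then obtain F where F: "F \<in> ?I" "card F = ?r" by (auto simp: matroid_rank_def)
  have max: "card F' \<le> card F" if "F' \<in> ?I" for F'
    unfolding F(2) matroid_rank_def using that finI by (intro Max_ge) auto
  \<comment> \<open>An edge of \<open>E\<close> between two components of \<open>F\<close> could be
    added to \<open>F\<close>, against maximality.\<close>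
  have same: "(adj F)\<^sup>* = (adj E)\<^sup>*"
  proof (intro equalityI rtrancl_subset_rtrancl)
    show "adj F \<subseteq> (adj E)\<^sup>*" using F(1) I adj_mono by blast
    show "adj E \<subseteq> (adj F)\<^sup>*"
    proof (clarify, rule ccontr)
      fix u v assume uv: "(u, v) \<in> adj E" "(u, v) \<notin> (adj F)\<^sup>*"
      then have "insert {u, v} F \<in> ?I" using F(1) forest_insert I by auto
      moreover have "{u, v} \<notin> F" using uv(2) by auto
      moreover have "finite F" using F(1) I finE finite_subset by blast
      ultimately show False using max[of "insert {u, v} F"] by simp
    qed
  qed
  have "?r + card (component F ` V) = card V"
    using card_forest[OF V(1), of F] F E I by auto
  then have "Suc ?r = card V \<longleftrightarrow> card (component F ` V) = 1" by auto
  then show ?thesis using card_components_eq_1_iff[OF V] same by simp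
qed

section \<open>Trails in a digraph and walks in its bipartite representation\<close>

definition rep_edges :: "('a, 'b) pre_digraph \<Rightarrow> ('a + 'a) set set" where
  "rep_edges D = uedges (bipartite_representation D)"

lemma rep_edges_Inl_Inr:
  "{Inl v, Inr w} \<in> rep_edges D \<longleftrightarrow> (\<exists>a \<in> arcs D. tail D a = v \<and> head D a = w)"
  by (auto simp: rep_edges_def bipartite_representation_def arcs_ends_def arc_to_ends_def
      doubleton_eq_iff)

lemma rep_edges_Inr_Inl:
  "{Inr w, Inl v} \<in> rep_edges D \<longleftrightarrow> (\<exists>a \<in> arcs D. tail D a = v \<and> head D a = w)"
  by (metis insert_commute rep_edges_Inl_Inr)

lemma rep_edges_same_side [simp]:
  "{Inl v, Inl w} \<notin> rep_edges D" "{Inr v, Inr w} \<notin> rep_edges D"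
  by (auto simp: rep_edges_def bipartite_representation_def doubleton_eq_iff)

lemma rep_edges_cases:
  assumes "{p, q} \<in> rep_edges D"
  obtains a where "a \<in> arcs D" "p = Inl (tail D a)" "q = Inr (head D a)"
  | a where "a \<in> arcs D" "p = Inr (head D a)" "q = Inl (tail D a)"
  using assms by (cases p; cases q) (auto simp: rep_edges_Inl_Inr rep_edges_Inr_Inl)

text \<open>A forward step goes from the left copy to the right one, a backward step the other way.
  Alternation lets each step start in the copy where the previous one ended, so the first and last
  flags fix the copies of the ends.\<close>

lemma alternating_walk_connected:
  assumes "underlying_walk D x ss y" "successively (\<lambda>s t. snd s \<noteq> snd t) ss" "ss \<noteq> []"
  shows "(if snd (hd ss) then Inl x else Inr x, if snd (last ss) then Inr y else Inl y)
    \<in> (adj (rep_edges D))\<^sup>*"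
  using assms
proof (induction ss arbitrary: x)
  case Nil
  then show ?case by simp
next
  case (Cons s ss)
  let ?z = "step_target D s"
  have step: "(if snd s then Inl x else Inr x, if snd s then Inr ?z else Inl ?z)
      \<in> adj (rep_edges D)"
    using Cons.prems(1)
    by (auto simp: step_source_def step_target_def rep_edges_Inl_Inr rep_edges_Inr_Inl)
  show ?case
  proof (cases "ss = []")
    case True
    then show ?thesis using step Cons.prems(1) by auto
  next
    case False
    then have "snd (hd ss) \<noteq> snd s" using Cons.prems(2) by (auto simp: successively_Cons)
    moreover have "(if snd (hd ss) then Inl ?z else Inr ?z,
        if snd (last ss) then Inr y else Inl y) \<in> (adj (rep_edges D))\<^sup>*"
      using Cons False by (auto simp: successively_Cons)
    ultimately show ?thesis
      using step False by (auto intro: converse_rtrancl_into_rtrancl simp del: adj_iff)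
  qed
qed

text \<open>One arc is chosen for each edge, traversed forward when the path leaves the left copy;
  \<open>case_sum id id\<close> forgets the copy. The last conjunct strengthens the induction: it
  shows that the arc prepended to the trail is not repeated.\<close>

lemma simple_path_antidirected_trail:
  assumes D: "wf_digraph D"
    and "distinct ps" "successively (\<lambda>p q. {p, q} \<in> rep_edges D) ps" "2 \<le> length ps"
  shows "\<exists>ss. ss \<noteq> [] \<and>
      antidirected_trail D (case_sum id id (hd ps)) ss (case_sum id id (last ps)) \<and>
      snd (hd ss) = isl (hd ps) \<and> snd (last ss) = (\<not> isl (last ps)) \<and>
      (\<forall>s \<in> set ss. Inl (tail D (fst s)) \<in> set ps \<and> Inr (head D (fst s)) \<in> set ps)"
  using assms(2-)
proof (induction ps)
  case Nil
  then show ?case by simp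
next
  case (Cons p ps)
  then obtain q qs where ps: "ps = q # qs" by (cases ps) auto
  then have "{p, q} \<in> rep_edges D" using Cons.prems(2) by simp
  then obtain s where s: "fst s \<in> arcs D" "snd s = isl p" "isl q = (\<not> isl p)"
    "step_source D s = case_sum id id p" "step_target D s = case_sum id id q"
    "{Inl (tail D (fst s)), Inr (head D (fst s))} = {p, q}"
  proof (cases rule: rep_edges_cases)
    case (1 a)
    then show ?thesis using that[of "(a, True)"] by (auto simp: step_source_def step_target_def)
  next
    case (2 a)
    then show ?thesis using that[of "(a, False)"] by (auto simp: step_source_def step_target_def)
  qed
  have q: "step_target D s \<in> verts D"
    using s(1) D by (simp add: step_target_def wf_digraph_def)
  show ?case
  proof (cases "qs = []")
    case True
    then show ?thesis using s q ps
      by (intro exI[of _ "[s]"]) (auto simp: antidirected_trail_def)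
  next
    case False
    then have "2 \<le> length ps" using ps by (cases qs) auto
    then obtain ss where ss: "ss \<noteq> []"
      "antidirected_trail D (case_sum id id q) ss (case_sum id id (last ps))"
      "snd (hd ss) = isl q" "snd (last ss) = (\<not> isl (last ps))"
      "\<forall>t \<in> set ss. Inl (tail D (fst t)) \<in> set ps \<and> Inr (head D (fst t)) \<in> set ps"
      using Cons.IH Cons.prems ps by auto
    \<comment> \<open>The edge of \<open>s\<close> ends in \<open>p\<close>, which no later edge of the simple path touches.\<close>
    have "fst s \<notin> fst ` set ss"
    proof
      assume "fst s \<in> fst ` set ss"
      then obtain t where "t \<in> set ss" "fst t = fst s" by force
      then have "{Inl (tail D (fst s)), Inr (head D (fst s))} \<subseteq> set ps"
        using ss(5) by (metis empty_subsetI insert_subset)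
      then have "p \<in> set ps" unfolding s(6) by simp
      then show False using Cons.prems(1) by auto
    qed
    moreover have "Inl (tail D (fst s)) \<in> set (p # ps)" "Inr (head D (fst s)) \<in> set (p # ps)"
      using s(6) ps by auto
    ultimately show ?thesis using s(1-5) ss ps
      by (intro exI[of _ "s # ss"])
        (simp add: antidirected_trail_def successively_Cons)
  qed
qed

text \<open>A simple path from the left copy to the right one has at least one edge, and its first
  and last steps are forward.\<close>

lemma connected_forward_antidirected_trail:
  assumes "wf_digraph D" "(Inl x, Inr y) \<in> (adj (rep_edges D))\<^sup>*"
  shows "\<exists>ss. forward_antidirected_trail D x ss y"
proof -
  obtain ps where ps: "ps \<noteq> []" "hd ps = Inl x" "last ps = Inr y" "distinct ps"
    "successively (\<lambda>p q. (p, q) \<in> adj (rep_edges D)) ps"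
    using rtrancl_simple_path[OF assms(2)] by metis
  have "2 \<le> length ps" using ps(1-3) by (cases ps; cases "tl ps") auto
  then show ?thesis
    using simple_path_antidirected_trail[OF assms(1) ps(4)] ps
    by (auto simp: forward_antidirected_trail_def)
qed

lemma antistrong_iff_connected:
  assumes "fin_digraph D" "loopfree_digraph D" "verts D \<noteq> {}"
  shows "antistrong D \<longleftrightarrow>
    (\<forall>p \<in> Inl ` verts D \<union> Inr ` verts D. \<forall>q \<in> Inl ` verts D \<union> Inr ` verts D.
       (p, q) \<in> (adj (rep_edges D))\<^sup>*)" (is "_ \<longleftrightarrow> ?conn")
proof
  interpret fin_digraph D by fact
  let ?R = "(adj (rep_edges D))\<^sup>*"
  assume anti: "antistrong D"
  have ne: "(Inl x, Inr y) \<in> ?R" if xy: "x \<in> verts D" "y \<in> verts D" "x \<noteq> y" for x y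
  proof -
    obtain ss where "forward_antidirected_trail D x ss y"
      using anti xy by (auto simp: antistrong_def)
    then show ?thesis
      using alternating_walk_connected[of D x ss y]
      by (auto simp: forward_antidirected_trail_def antidirected_trail_def)
  qed
  have other: "\<exists>z \<in> verts D. z \<noteq> x \<and> z \<noteq> y" for x y
  proof -
    have "card {x, y} < card (verts D)"
      using anti by (auto simp: antistrong_def card_insert_if)
    then show ?thesis by (metis card_mono finite.emptyI finite.insertI insertCI leD subsetI)
  qed
  have lr: "(Inl x, Inr y) \<in> ?R" if xy: "x \<in> verts D" "y \<in> verts D" for x y
  proof (cases "x = y")
    case True
    obtain z where z: "z \<in> verts D" "z \<noteq> x" using other by blast
    obtain w where w: "w \<in> verts D" "w \<noteq> x" "w \<noteq> z" using other by blast
    \<comment> \<open>The route is \<open>Inl x\<close>, \<open>Inr z\<close>, \<open>Inl w\<close>,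
      \<open>Inr x\<close>, whose consecutive entries belong to distinct vertices.\<close>
    show ?thesis
      using ne[of x z] ne[of w z, THEN adj_rtrancl_sym] ne[of w x] xy z w True
      by (metis rtrancl_trans)
  next
    case False
    then show ?thesis using ne xy by blast
  qed
  have rl: "(Inr x, Inl y) \<in> ?R" if "x \<in> verts D" "y \<in> verts D" for x y
    using lr that adj_rtrancl_sym by metis
  \<comment> \<open>Two vertices in the same copy are joined through the other copy.\<close>
  have "(Inl x, Inl y) \<in> ?R" "(Inr x, Inr y) \<in> ?R" if "x \<in> verts D" "y \<in> verts D" for x y
    using lr rl that by (meson rtrancl_trans)+
  then show ?conn using lr rl by blast
next
  interpret fin_digraph D by fact
  interpret loopfree_digraph D by fact
  assume conn: ?conn
  obtain x where x: "x \<in> verts D" using assms(3) by blast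
  have "3 \<le> card (verts D)"
  proof (rule ccontr)
    assume "\<not> 3 \<le> card (verts D)"
    then have le: "card (verts D) \<le> 2" by simp
    \<comment> \<open>With at most two vertices, an arc whose head is not \<open>x\<close> has tail
      \<open>x\<close>, because it is not a loop.\<close>
    have two: "v = x" if "v \<in> verts D" "w \<in> verts D" "w \<noteq> x" "v \<noteq> w" for v w
    proof (rule ccontr)
      assume "v \<noteq> x"
      then have "card {v, w, x} = 3" using that by simp
      moreover have "card {v, w, x} \<le> card (verts D)"
        using that x by (intro card_mono) auto
      ultimately show False using le by simp
    qed
    \<comment> \<open>The component of \<open>Inl x\<close> is contained in the following set, which misses \<open>Inr x\<close>.\<close>
    let ?S = "insert (Inl x) (Inr ` (verts D - {x}))"
    have "p \<in> ?S" if "(Inl x, p) \<in> (adj (rep_edges D))\<^sup>*" for p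
      using that
    proof (induction rule: rtrancl_induct)
      case base
      show ?case by simp
    next
      case (step p q)
      then have "{p, q} \<in> rep_edges D" by simp
      then show ?case
      proof (cases rule: rep_edges_cases)
        case (1 a)
        \<comment> \<open>Here the tail is \<open>x\<close>, and the arc is no loop, so its head
          differs from \<open>x\<close>.\<close>
        then show ?thesis using step.IH no_loops by fastforce
      next
        case (2 a)
        then have "head D a \<noteq> x" using step.IH by auto
        then have "tail D a = x" using 2 two[of "tail D a" "head D a"] no_loops by auto
        then show ?thesis using 2 by simp
      qed
    qed
    then have "Inr x \<in> ?S" using conn x by blast
    then show False by auto
  qed
  then show "antistrong D"
    using conn connected_forward_antidirected_trail[OF wf_digraph_axioms]
    by (auto simp: antistrong_def)
qed

theorem theorem5p3:
  fixes D :: "('a, 'b) pre_digraph"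
  assumes "fin_digraph D" and "loopfree_digraph D"
  shows "antistrong D \<longleftrightarrow>
    int (matroid_rank (cycle_matroid (bipartite_representation D))) = 2 * int (card (verts D)) - 1"
proof (cases "verts D = {}")
  case True
  \<comment> \<open>Both sides are false: three vertices are required on the left, and on the right
    the integer difference is -1, which is not a rank.\<close>
  then show ?thesis by (simp add: antistrong_def)
next
  case False
  interpret fin_digraph D by fact
  let ?V = "Inl ` verts D \<union> Inr ` verts D"
  have rep: "bipartite_representation D = \<lparr>uverts = ?V, uedges = rep_edges D\<rparr>"
    by (simp add: rep_edges_def bipartite_representation_def)
  have "rep_edges D \<subseteq> edges_on ?V"
  proof
    fix e assume e: "e \<in> rep_edges D"
    then obtain v w where vw: "e = {Inl v, Inr w}"
      by (auto simp: rep_edges_def bipartite_representation_def)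
    then show "e \<in> edges_on ?V"
      using e by (auto simp: rep_edges_Inl_Inr edges_on_doubleton)
  qed
  then have "Suc (matroid_rank (cycle_matroid (bipartite_representation D))) = card ?V \<longleftrightarrow>
      antistrong D"
    using matroid_rank_connected_iff[of ?V "rep_edges D"] False
      antistrong_iff_connected[OF assms False] by (simp add: rep)
  \<comment> \<open>The two copies are disjoint, so a spanning tree of the bipartite representation
    has one edge fewer than twice the number of vertices of \<open>D\<close>.\<close>
  moreover have "card ?V = 2 * card (verts D)"
    by (subst card_Un_disjoint) (auto simp: card_image)
  ultimately show ?thesis by linarith
qed

end
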